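(* Let $d\ge1$ and let $\Phi:M_d(\mathbb{C})\to M_d(\mathbb{C})$ be a completely positive trace-preserving (CPT) map. If $\Phi$ can be written with fewer than $d$ Kraus operators, i.e. $\Phi(\rho)=\sum_{k=1}^rA_k\rho A_k^\dagger$ with $A_k\in M_d(\mathbb{C})$ and $r<d$, then $\Phi$ is not EBT.
   Context: $M_d(\mathbb{C})$ is the algebra of complex $d\times d$ matrices. A density matrix (positive semi-definite, trace one) on a tensor product of two finite-dimensional Hilbert spaces is separable if it is a convex combination of tensor products of density matrices. A CPT map $\Phi$ on $M_d(\mathbb{C})$ is EBT (entanglement breaking and trace-preserving) if $(I\otimes\Phi)(\Gamma)$ is separable for every density matrix $\Gamma$ on $\mathbb{C}^n\otimes\mathbb{C}^d$ and every $n\ge1$ (here $I$ is the identity map on $M_n(\mathbb{C})$). *)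

theory Defs
  imports "Jordan_Normal_Form.Schur_Decomposition"
begin

definition matrix_trace :: "complex mat \<Rightarrow> complex" where
  "matrix_trace A = (\<Sum>i<dim_row A. A $$ (i, i))"

definition matrix_sum :: "nat \<Rightarrow> ('i \<Rightarrow> complex mat) \<Rightarrow> 'i set \<Rightarrow> complex mat" where
  "matrix_sum n F K = mat n n (\<lambda>(i, j). \<Sum>k\<in>K. F k $$ (i, j))"

definition pos_semidef :: "nat \<Rightarrow> complex mat \<Rightarrow> bool" where
  "pos_semidef n A \<longleftrightarrow> A \<in> carrier_mat n n \<and> mat_adjoint A = A \<and>
     (\<forall>v\<in>carrier_vec n. 0 \<le> Re ((A *\<^sub>v v) \<bullet>c v))"

definition density_matrix :: "nat \<Rightarrow> complex mat \<Rightarrow> bool" where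
  "density_matrix n \<rho> \<longleftrightarrow> pos_semidef n \<rho> \<and> matrix_trace \<rho> = 1"

(* Tensor product of A in M_n and B in M_d. Here and below, C^n (x) C^d is identified with C^(n*d)
   by sending e_i (x) e_k to the basis vector with index i * d + k. *)
definition tensor_mat :: "nat \<Rightarrow> nat \<Rightarrow> complex mat \<Rightarrow> complex mat \<Rightarrow> complex mat" where
  "tensor_mat n d A B = mat (n * d) (n * d)
     (\<lambda>(a, b). A $$ (a div d, b div d) * B $$ (a mod d, b mod d))"

(* The (i,j) block of Gamma, i.e. the matrix Gamma_ij in Gamma = sum_ij E_ij (x) Gamma_ij. *)
definition tensor_block :: "nat \<Rightarrow> complex mat \<Rightarrow> nat \<Rightarrow> nat \<Rightarrow> complex mat" where
  "tensor_block d \<Gamma> i j = mat d d (\<lambda>(k, l). \<Gamma> $$ (i * d + k, j * d + l))"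

(* I (x) Phi with I the identity map on M_n: sends sum_ij E_ij (x) Gamma_ij to
   sum_ij E_ij (x) Phi(Gamma_ij). See id_tensor_map_tensor_mat below. *)
definition id_tensor_map :: "nat \<Rightarrow> nat \<Rightarrow> (complex mat \<Rightarrow> complex mat) \<Rightarrow> complex mat \<Rightarrow> complex mat" where
  "id_tensor_map n d \<Phi> \<Gamma> = mat (n * d) (n * d)
     (\<lambda>(a, b). \<Phi> (tensor_block d \<Gamma> (a div d) (b div d)) $$ (a mod d, b mod d))"

(* A map on M_d is represented by its values on carrier_mat d d; other values are irrelevant. *)
definition linear_map :: "nat \<Rightarrow> (complex mat \<Rightarrow> complex mat) \<Rightarrow> bool" where
  "linear_map d \<Phi> \<longleftrightarrow>
     (\<forall>X\<in>carrier_mat d d. \<Phi> X \<in> carrier_mat d d) \<and>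
     (\<forall>X\<in>carrier_mat d d. \<forall>Y\<in>carrier_mat d d. \<Phi> (X + Y) = \<Phi> X + \<Phi> Y) \<and>
     (\<forall>X\<in>carrier_mat d d. \<forall>c. \<Phi> (c \<cdot>\<^sub>m X) = c \<cdot>\<^sub>m \<Phi> X)"

definition completely_positive :: "nat \<Rightarrow> (complex mat \<Rightarrow> complex mat) \<Rightarrow> bool" where
  "completely_positive d \<Phi> \<longleftrightarrow> linear_map d \<Phi> \<and>
     (\<forall>n\<ge>1. \<forall>\<Gamma>. pos_semidef (n * d) \<Gamma> \<longrightarrow> pos_semidef (n * d) (id_tensor_map n d \<Phi> \<Gamma>))"

definition trace_preserving :: "nat \<Rightarrow> (complex mat \<Rightarrow> complex mat) \<Rightarrow> bool" where
  "trace_preserving d \<Phi> \<longleftrightarrow> (\<forall>X\<in>carrier_mat d d. matrix_trace (\<Phi> X) = matrix_trace X)"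

definition CPT :: "nat \<Rightarrow> (complex mat \<Rightarrow> complex mat) \<Rightarrow> bool" where
  "CPT d \<Phi> \<longleftrightarrow> completely_positive d \<Phi> \<and> trace_preserving d \<Phi>"

definition separable :: "nat \<Rightarrow> nat \<Rightarrow> complex mat \<Rightarrow> bool" where
  "separable n d \<Gamma> \<longleftrightarrow> density_matrix (n * d) \<Gamma> \<and>
     (\<exists>(m::nat) (p :: nat \<Rightarrow> real) \<rho> \<sigma>.
        (\<forall>k<m. 0 \<le> p k \<and> density_matrix n (\<rho> k) \<and> density_matrix d (\<sigma> k)) \<and>
        (\<Sum>k<m. p k) = 1 \<and>
        \<Gamma> = matrix_sum (n * d) (\<lambda>k. complex_of_real (p k) \<cdot>\<^sub>m tensor_mat n d (\<rho> k) (\<sigma> k)) {..<m})"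

definition EBT :: "nat \<Rightarrow> (complex mat \<Rightarrow> complex mat) \<Rightarrow> bool" where
  "EBT d \<Phi> \<longleftrightarrow> CPT d \<Phi> \<and>
     (\<forall>n\<ge>1. \<forall>\<Gamma>. density_matrix (n * d) \<Gamma> \<longrightarrow> separable n d (id_tensor_map n d \<Phi> \<Gamma>))"

lemma id_tensor_map_tensor_mat:
  assumes "linear_map d \<Phi>" and "A \<in> carrier_mat n n" and B: "B \<in> carrier_mat d d"
  shows "id_tensor_map n d \<Phi> (tensor_mat n d A B) = tensor_mat n d A (\<Phi> B)"
proof (rule eq_matI)
  fix a b
  assume "a < dim_row (tensor_mat n d A (\<Phi> B))" "b < dim_col (tensor_mat n d A (\<Phi> B))"
  then have ab: "a < n * d" "b < n * d" by (auto simp: tensor_mat_def)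
  then have d: "0 < d" by (cases d) auto
  have div: "a div d < n" "b div d < n" and mod: "a mod d < d" "b mod d < d"
    using ab d by (auto simp: less_mult_imp_div_less)
  have lt: "i * d + k < n * d" if "i < n" "k < d" for i k :: nat
  proof -
    have "i * d + k < Suc i * d" using that by simp
    also have "\<dots> \<le> n * d" using that by (intro mult_le_mono1) simp
    finally show ?thesis .
  qed
  have "tensor_block d (tensor_mat n d A B) (a div d) (b div d) = A $$ (a div d, b div d) \<cdot>\<^sub>m B"
    using B d div lt by (intro eq_matI) (auto simp: tensor_block_def tensor_mat_def)
  moreover have "\<Phi> (A $$ (a div d, b div d) \<cdot>\<^sub>m B) = A $$ (a div d, b div d) \<cdot>\<^sub>m \<Phi> B"
    and "\<Phi> B \<in> carrier_mat d d"
    using assms by (auto simp: linear_map_def)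
  ultimately show "id_tensor_map n d \<Phi> (tensor_mat n d A B) $$ (a, b) = tensor_mat n d A (\<Phi> B) $$ (a, b)"
    using ab mod by (auto simp: id_tensor_map_def tensor_mat_def)
qed (auto simp: id_tensor_map_def tensor_mat_def)

end

(* Let |a_k> in C^d (x) C^d be the vectorisation of A_k. The Choi matrix of Phi, that is d times the
   image of the maximally entangled state under I (x) Phi, is J = sum_k |a_k><a_k|, and since Phi
   preserves the trace, its marginal on the first factor is the identity. A separable state is
   dominated by (marginal) (x) 1, because s <= (tr s) 1 for every positive semidefinite s; so if Phi
   is EBT, then J <= 1. Testing this on a_k gives |a_k|^4 <= <a_k|J|a_k> <= |a_k|^2, hence
   |a_k|^2 <= 1, while sum_k |a_k|^2 = tr J = d. So there are at least d Kraus operators. *)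

theory Submission
  imports Defs "HOL-Analysis.L2_Norm"
begin

section \<open>Hermitian forms on finite index sets: Gram representation and domination by the
  trace\<close>

definition hform :: "'a set \<Rightarrow> ('a \<Rightarrow> 'a \<Rightarrow> complex) \<Rightarrow> ('a \<Rightarrow> complex) \<Rightarrow> complex" where
  "hform S f x = (\<Sum>i\<in>S. \<Sum>j\<in>S. cnj (x i) * f i j * x j)"

text \<open>Arbitrary index sets are used instead of matrices so that a tensor product lives on
  \<open>S \<times> T\<close> without \<open>div\<close> and \<open>mod\<close>, and so that
  induction can add one index at a time. Only the values of \<open>x\<close> on \<open>S\<close>
  enter the form.\<close>

definition psd_kernel :: "'a set \<Rightarrow> ('a \<Rightarrow> 'a \<Rightarrow> complex) \<Rightarrow> bool" where
  "psd_kernel S f \<longleftrightarrow> (\<forall>i\<in>S. \<forall>j\<in>S. f j i = cnj (f i j)) \<and> (\<forall>x. 0 \<le> Re (hform S f x))"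

lemma psd_kernelD:
  assumes "psd_kernel S f"
  shows "i \<in> S \<Longrightarrow> j \<in> S \<Longrightarrow> f j i = cnj (f i j)" "0 \<le> Re (hform S f x)"
  using assms unfolding psd_kernel_def by blast+

lemma hform_insert:
  assumes "finite S" "s \<notin> S"
  shows "hform (insert s S) f x = cnj (x s) * f s s * x s + cnj (x s) * (\<Sum>j\<in>S. f s j * x j)
    + (\<Sum>i\<in>S. cnj (x i) * f i s) * x s + hform S f x"
  using assms by (simp add: hform_def sum.distrib sum_distrib_left sum_distrib_right algebra_simps)

lemma hform_cong:
  assumes "\<And>i. i \<in> S \<Longrightarrow> x i = y i"
  shows "hform S f x = hform S f y"
  using assms by (auto simp: hform_def intro!: sum.cong)

lemma psd_kernel_diag:
  assumes "psd_kernel S f" "s \<in> S" "finite S"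
  shows "f s s = of_real (Re (f s s))" "0 \<le> Re (f s s)"
proof -
  have "f s s = cnj (f s s)" by (rule psd_kernelD(1) [OF assms(1,2,2)])
  then show "f s s = of_real (Re (f s s))" by (simp add: complex_eq_iff)
  have "hform S f (\<lambda>i. if i = s then 1 else 0) = f s s"
    using assms by (simp add: hform_def if_distrib [of cnj] if_distrib [of "\<lambda>z. z * _"] if_distrib [of "\<lambda>z. _ * z"] cong: if_cong)
  then show "0 \<le> Re (f s s)" using psd_kernelD(2) [OF assms(1), of "\<lambda>i. if i = s then 1 else 0"] by simp
qed

(* The off-diagonal entry is detected by the test vector - t (f s i) e_s + e_i for large t. *)
lemma psd_kernel_zero_diag:
  assumes "psd_kernel (insert s S) f" "finite S" "s \<notin> S" "f s s = 0" "i \<in> S"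
  shows "f s i = 0"
proof (rule ccontr)
  assume nz: "f s i \<noteq> 0"
  \<comment> \<open>Chosen such that \<open>2 * t * (cmod (f s i))^2\<close> is twice
    \<open>Re (f i i) + 1\<close>; the form then takes the value \<open>- Re (f i i) - 2\<close>,
    which is negative.\<close>
  define t where "t = (Re (f i i) + 1) / (cmod (f s i))\<^sup>2"
  define x where "x = (\<lambda>j. if j = s then - of_real t * f s i else if j = i then 1 else 0)"
  have "i \<noteq> s" using assms by auto
  have herm: "f i s = cnj (f s i)" using psd_kernelD(1) [OF assms(1)] assms(5) by blast
  have S: "x j = (if j = i then 1 else 0)" if "j \<in> S" for j using that assms by (auto simp: x_def)
  have 1: "(\<Sum>j\<in>S. f s j * x j) = f s i"
    using assms by (simp add: S if_distrib [of cnj] if_distrib [of "\<lambda>z. z * _"] if_distrib [of "\<lambda>z. _ * z"] cong: if_cong)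
  have 2: "(\<Sum>j\<in>S. cnj (x j) * f j s) = cnj (f s i)"
    using assms by (simp add: S herm if_distrib [of cnj] if_distrib [of "\<lambda>z. z * _"] if_distrib [of "\<lambda>z. _ * z"] cong: if_cong)
  have 3: "hform S f x = f i i"
    using assms by (simp add: hform_def S if_distrib [of cnj] if_distrib [of "\<lambda>z. z * _"] if_distrib [of "\<lambda>z. _ * z"] cong: if_cong)
  have "Re (hform (insert s S) f x) = Re (f i i) - 2 * t * (cmod (f s i))\<^sup>2"
    unfolding hform_insert [OF assms(2,3)] 1 2 3 cmod_power2
    by (simp add: x_def assms power2_eq_square algebra_simps)
  also have "\<dots> = - Re (f i i) - 2" using nz by (simp add: t_def)
  finally have "0 \<le> - Re (f i i) - 2" using psd_kernelD(2) [OF assms(1), of x] by simp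
  moreover have "0 \<le> Re (f i i)" using psd_kernel_diag(2) [OF assms(1)] assms by auto
  ultimately show False by simp
qed

text \<open>Cholesky decomposition by induction: the column of the new index \<open>s\<close>,
  divided by the root of the pivot, splits off a rank-one term, and the rest is the Schur complement
  on \<open>S\<close>. There is one Gram vector per pivot, so \<open>S\<close> itself indexes
  them.\<close>

lemma psd_kernel_gram:
  assumes "finite S" "psd_kernel S f"
  shows "\<exists>X. \<forall>i\<in>S. \<forall>j\<in>S. f i j = (\<Sum>a\<in>S. X a i * cnj (X a j))"
  using assms
proof (induction S arbitrary: f)
  case (insert s S)
  define c where "c = Re (f s s)"
  have fss: "f s s = of_real c" and c: "0 \<le> c"
    using psd_kernel_diag [OF insert.prems, of s] insert.hyps by (auto simp: c_def)
  have herm: "f j i = cnj (f i j)" if "i \<in> insert s S" "j \<in> insert s S" for i j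
    using psd_kernelD(1) [OF insert.prems that] .
  have pos: "0 \<le> Re (hform (insert s S) f x)" for x
    using psd_kernelD(2) [OF insert.prems] .
  have col: "f i s = 0" "f s i = 0" if "c = 0" "i \<in> S" for i
    using psd_kernel_zero_diag [OF insert.prems insert.hyps(1,2), of i] that fss herm[of s i] by auto
  (* Schur complement of the entry c. If c = 0, then g = f because x / 0 = 0, and the row s of f
     vanishes by col. *)
  define g where "g = (\<lambda>i j. f i j - f i s * f s j / of_real c)"
  have "psd_kernel S g"
    unfolding psd_kernel_def
  proof (intro conjI ballI allI)
    fix i j assume "i \<in> S" "j \<in> S"
    then show "g j i = cnj (g i j)" using herm[of i j] herm[of s j] herm[of s i] by (simp add: g_def)
  next
    fix x
    define u where "u = (\<Sum>j\<in>S. f s j * x j)"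
    \<comment> \<open>For positive \<open>c\<close> this value at \<open>s\<close> minimises the
      form of \<open>f\<close> with the other coordinates fixed, and the minimum is the form of the
      Schur complement. For \<open>c = 0\<close> division by zero gives
      \<open>y s = 0\<close>.\<close>
    define y where "y = x(s := - u / of_real c)"
    have u': "(\<Sum>i\<in>S. cnj (x i) * f i s) = cnj u"
      unfolding u_def cnj_sum
    proof (intro sum.cong refl)
      fix i assume "i \<in> S"
      then show "cnj (x i) * f i s = cnj (f s i * x i)" using herm [of s i] by simp
    qed
    have S: "y j = x j" if "j \<in> S" for j using that insert.hyps by (auto simp: y_def)
    have "hform S g x = hform S f x - (\<Sum>i\<in>S. cnj (x i) * f i s) * u / of_real c"
      unfolding hform_def g_def u_def sum_product sum_divide_distrib sum_subtractf [symmetric]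
      by (intro sum.cong refl) (simp add: algebra_simps)
    also have "\<dots> = hform (insert s S) f y"
    proof -
      have 1: "(\<Sum>j\<in>S. f s j * y j) = u"
        unfolding u_def by (intro sum.cong refl) (simp add: S)
      have 2: "(\<Sum>i\<in>S. cnj (y i) * f i s) = cnj u"
        unfolding u' [symmetric] by (intro sum.cong refl) (simp add: S)
      have 3: "hform S f y = hform S f x"
        using S by (rule hform_cong)
      show ?thesis unfolding hform_insert [OF insert.hyps(1,2)] u' 1 2 3
        by (cases "c = 0") (simp_all add: y_def fss field_simps)
    qed
    finally show "0 \<le> Re (hform S g x)" using pos by simp
  qed
  then obtain X where X: "\<And>i j. i \<in> S \<Longrightarrow> j \<in> S \<Longrightarrow> g i j = (\<Sum>a\<in>S. X a i * cnj (X a j))"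
    using insert.IH by blast
  \<comment> \<open>The induction hypothesis says nothing about \<open>X a s\<close>, hence the
    explicit 0 there: row and column \<open>s\<close> come from the new Gram vector alone.\<close>
  define Y where "Y = (\<lambda>a i. if a = s then f i s / of_real (sqrt c) else if i = s then 0 else X a i)"
  have sq: "complex_of_real (sqrt c) * complex_of_real (sqrt c) = of_real c"
    using c by (simp flip: of_real_mult)
  show ?case
  proof (intro exI ballI)
    fix i j assume i: "i \<in> insert s S" and j: "j \<in> insert s S"
    have "(\<Sum>a\<in>insert s S. Y a i * cnj (Y a j))
        = f i s * cnj (f j s) / of_real c + (\<Sum>a\<in>S. Y a i * cnj (Y a j))"
      using insert.hyps sq by (simp add: Y_def)
    also have "(\<Sum>a\<in>S. Y a i * cnj (Y a j)) = (\<Sum>a\<in>S. if i = s \<or> j = s then 0 else X a i * cnj (X a j))"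
      using insert.hyps by (intro sum.cong) (auto simp: Y_def)
    also have "\<dots> = (if i = s \<or> j = s then 0 else g i j)"
      using i j X by auto
    also have "cnj (f j s) = f s j" by (rule herm [OF j, symmetric]) simp
    also have "f i s * f s j / of_real c + (if i = s \<or> j = s then 0 else g i j) = f i j"
      using i j col fss by (cases "c = 0") (auto simp: g_def)
    finally show "f i j = (\<Sum>a\<in>insert s S. Y a i * cnj (Y a j))" by simp
  qed
qed simp

text \<open>The polarised version with two vectors is needed because the tensor estimate pairs two
  different slices of one vector.\<close>

lemma sesquilinear_gram:
  fixes x y :: "'a \<Rightarrow> complex"
  assumes "\<And>i j. i \<in> S \<Longrightarrow> j \<in> S \<Longrightarrow> f i j = (\<Sum>a\<in>T. X a i * cnj (X a j))"
  shows "(\<Sum>i\<in>S. \<Sum>j\<in>S. cnj (x i) * f i j * y j)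
    = (\<Sum>a\<in>T. cnj (\<Sum>i\<in>S. cnj (X a i) * x i) * (\<Sum>i\<in>S. cnj (X a i) * y i))"
proof -
  have "(\<Sum>i\<in>S. \<Sum>j\<in>S. cnj (x i) * f i j * y j)
      = (\<Sum>i\<in>S. \<Sum>j\<in>S. \<Sum>a\<in>T. (X a i * cnj (x i)) * (cnj (X a j) * y j))"
    using assms by (auto simp: sum_distrib_left sum_distrib_right algebra_simps intro!: sum.cong)
  also have "\<dots> = (\<Sum>i\<in>S. \<Sum>a\<in>T. \<Sum>j\<in>S. (X a i * cnj (x i)) * (cnj (X a j) * y j))"
    by (intro sum.cong sum.swap refl)
  also have "\<dots> = (\<Sum>a\<in>T. \<Sum>i\<in>S. \<Sum>j\<in>S. (X a i * cnj (x i)) * (cnj (X a j) * y j))"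
    by (rule sum.swap)
  also have "\<dots> = (\<Sum>a\<in>T. cnj (\<Sum>i\<in>S. cnj (X a i) * x i) * (\<Sum>i\<in>S. cnj (X a i) * y i))"
    by (simp add: sum_product)
  finally show ?thesis .
qed

lemma hform_gram:
  assumes "\<And>i j. i \<in> S \<Longrightarrow> j \<in> S \<Longrightarrow> f i j = (\<Sum>a\<in>T. X a i * cnj (X a j))"
  shows "hform S f x = of_real (\<Sum>a\<in>T. (cmod (\<Sum>i\<in>S. cnj (X a i) * x i))\<^sup>2)"
  using sesquilinear_gram [OF assms, where x = x and y = x]
  by (simp only: hform_def of_real_sum complex_norm_square mult.commute [of "cnj (sum _ _)"])

text \<open>Cauchy-Schwarz; the triangle inequality reduces it to the real inequality for
  \<open>L2_set\<close>.\<close>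

lemma cmod_sum_mult_le:
  "(cmod (\<Sum>i\<in>S. a i * b i))\<^sup>2 \<le> (\<Sum>i\<in>S. (cmod (a i))\<^sup>2) * (\<Sum>i\<in>S. (cmod (b i))\<^sup>2)"
proof -
  have "cmod (\<Sum>i\<in>S. a i * b i) \<le> (\<Sum>i\<in>S. \<bar>cmod (a i)\<bar> * \<bar>cmod (b i)\<bar>)"
    by (rule order_trans [OF norm_sum]) (simp add: norm_mult)
  also have "\<dots> \<le> L2_set (\<lambda>i. cmod (a i)) S * L2_set (\<lambda>i. cmod (b i)) S"
    by (rule L2_set_mult_ineq)
  finally show ?thesis
    by (auto dest: power_mono [of _ _ 2] simp: power_mult_distrib L2_set_def sum_nonneg)
qed

text \<open>Cauchy-Schwarz bounds the contribution of each Gram vector by its squared norm times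
  that of \<open>x\<close>, and the squared norms of the Gram vectors add up to the trace.\<close>

lemma hform_le_trace:
  assumes "finite S" "psd_kernel S f"
  shows "Re (hform S f x) \<le> Re (\<Sum>i\<in>S. f i i) * (\<Sum>i\<in>S. (cmod (x i))\<^sup>2)"
proof -
  obtain X where X: "\<And>i j. i \<in> S \<Longrightarrow> j \<in> S \<Longrightarrow> f i j = (\<Sum>a\<in>S. X a i * cnj (X a j))"
    using psd_kernel_gram [OF assms] by blast
  have "Re (hform S f x) = (\<Sum>a\<in>S. (cmod (\<Sum>i\<in>S. cnj (X a i) * x i))\<^sup>2)"
    by (simp only: hform_gram [OF X] Re_complex_of_real)
  also have "\<dots> \<le> (\<Sum>a\<in>S. (\<Sum>i\<in>S. (cmod (X a i))\<^sup>2) * (\<Sum>i\<in>S. (cmod (x i))\<^sup>2))"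
    using cmod_sum_mult_le [where a = "\<lambda>i. cnj (X _ i)"] by (intro sum_mono) simp
  also have "\<dots> = (\<Sum>i\<in>S. \<Sum>a\<in>S. (cmod (X a i))\<^sup>2) * (\<Sum>i\<in>S. (cmod (x i))\<^sup>2)"
    by (subst sum.swap) (simp add: sum_distrib_right)
  also have "(\<Sum>i\<in>S. \<Sum>a\<in>S. (cmod (X a i))\<^sup>2) = Re (\<Sum>i\<in>S. f i i)"
    by (simp add: X complex_mult_cnj cmod_power2)
  finally show ?thesis .
qed

text \<open>In operator terms, f (x) g \<le> (tr g) (f (x) 1). The Gram vectors of \<open>f\<close>
  remove the first factor, which leaves forms of \<open>g\<close> on \<open>T\<close>, and
  \<open>hform_le_trace\<close> applies to each of these.\<close>

lemma hform_tensor_le: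
  assumes "finite S" "finite T" "psd_kernel S f" "psd_kernel T g"
  shows "Re (hform (S \<times> T) (\<lambda>(i, k) (j, l). f i j * g k l) v)
    \<le> Re (\<Sum>k\<in>T. g k k) * Re (\<Sum>k\<in>T. hform S f (\<lambda>i. v (i, k)))"
proof -
  obtain X where X: "\<And>i j. i \<in> S \<Longrightarrow> j \<in> S \<Longrightarrow> f i j = (\<Sum>a\<in>S. X a i * cnj (X a j))"
    using psd_kernel_gram [OF assms(1,3)] by blast
  \<comment> \<open>The partial inner product of \<open>v\<close> with the Gram vector
    \<open>X a\<close> in the first factor, a vector on \<open>T\<close>.\<close>
  define w where "w = (\<lambda>a k. \<Sum>i\<in>S. cnj (X a i) * v (i, k))"
  have "hform (S \<times> T) (\<lambda>(i, k) (j, l). f i j * g k l) v =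
      (\<Sum>(i, k)\<in>S \<times> T. \<Sum>(j, l)\<in>S \<times> T. g k l * (cnj (v (i, k)) * f i j * v (j, l)))"
    unfolding hform_def by (intro sum.cong refl) (auto simp: algebra_simps intro!: sum.cong)
  also have "\<dots> = (\<Sum>i\<in>S. \<Sum>k\<in>T. \<Sum>j\<in>S. \<Sum>l\<in>T. g k l * (cnj (v (i, k)) * f i j * v (j, l)))"
    by (simp add: sum.cartesian_product [symmetric])
  also have "\<dots> = (\<Sum>k\<in>T. \<Sum>i\<in>S. \<Sum>l\<in>T. \<Sum>j\<in>S. g k l * (cnj (v (i, k)) * f i j * v (j, l)))"
    by (subst sum.swap) (intro sum.cong sum.swap refl)
  also have "\<dots> = (\<Sum>k\<in>T. \<Sum>l\<in>T. \<Sum>i\<in>S. \<Sum>j\<in>S. g k l * (cnj (v (i, k)) * f i j * v (j, l)))"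
    by (intro sum.cong sum.swap refl)
  also have "\<dots> = (\<Sum>k\<in>T. \<Sum>l\<in>T. g k l * (\<Sum>a\<in>S. cnj (w a k) * w a l))"
    by (simp only: sum_distrib_left [symmetric] sesquilinear_gram [OF X] w_def)
  also have "\<dots> = (\<Sum>k\<in>T. \<Sum>l\<in>T. \<Sum>a\<in>S. cnj (w a k) * g k l * w a l)"
    by (simp add: sum_distrib_left mult.assoc mult.left_commute)
  also have "\<dots> = (\<Sum>k\<in>T. \<Sum>a\<in>S. \<Sum>l\<in>T. cnj (w a k) * g k l * w a l)"
    by (intro sum.cong sum.swap refl)
  also have "\<dots> = (\<Sum>a\<in>S. hform T g (w a))"
    unfolding hform_def by (rule sum.swap)
  finally have "Re (hform (S \<times> T) (\<lambda>(i, k) (j, l). f i j * g k l) v) = (\<Sum>a\<in>S. Re (hform T g (w a)))"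
    by simp
  also have "\<dots> \<le> (\<Sum>a\<in>S. Re (\<Sum>k\<in>T. g k k) * (\<Sum>k\<in>T. (cmod (w a k))\<^sup>2))"
    using assms by (intro sum_mono hform_le_trace)
  also have "\<dots> = Re (\<Sum>k\<in>T. g k k) * (\<Sum>k\<in>T. \<Sum>a\<in>S. (cmod (w a k))\<^sup>2)"
    by (simp only: sum_distrib_left sum.swap [of _ S T])
  also have "(\<Sum>k\<in>T. \<Sum>a\<in>S. (cmod (w a k))\<^sup>2) = Re (\<Sum>k\<in>T. hform S f (\<lambda>i. v (i, k)))"
    by (simp only: hform_gram [OF X] w_def of_real_sum [symmetric] Re_complex_of_real)
  finally show ?thesis .
qed

section \<open>Convex combinations and the reduction criterion\<close>

lemma hform_sum:
  "hform S (\<lambda>i j. \<Sum>m\<in>M. c m * f m i j) x = (\<Sum>m\<in>M. c m * hform S (f m) x)"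
proof -
  have "hform S (\<lambda>i j. \<Sum>m\<in>M. c m * f m i j) x
      = (\<Sum>i\<in>S. \<Sum>j\<in>S. \<Sum>m\<in>M. c m * (cnj (x i) * f m i j * x j))"
    unfolding hform_def sum_distrib_left sum_distrib_right
    by (intro sum.cong refl) (simp add: algebra_simps)
  also have "\<dots> = (\<Sum>i\<in>S. \<Sum>m\<in>M. \<Sum>j\<in>S. c m * (cnj (x i) * f m i j * x j))"
    by (intro sum.cong sum.swap refl)
  also have "\<dots> = (\<Sum>m\<in>M. \<Sum>i\<in>S. \<Sum>j\<in>S. c m * (cnj (x i) * f m i j * x j))"
    by (rule sum.swap)
  finally show ?thesis by (simp only: hform_def sum_distrib_left)
qed

text \<open>The bound for product kernels is preserved by nonnegative combinations. As every
  \<open>g m\<close> has trace one, the combination of the \<open>f m\<close> is the first marginal,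
  so the right side is the form of (marginal) (x) 1 at \<open>v\<close>.\<close>

lemma reduction_criterion:
  fixes p :: "'m \<Rightarrow> real"
  assumes fin: "finite S" "finite T"
    and p: "\<And>m. m \<in> M \<Longrightarrow> 0 \<le> p m"
    and f: "\<And>m. m \<in> M \<Longrightarrow> psd_kernel S (f m)"
    and g: "\<And>m. m \<in> M \<Longrightarrow> psd_kernel T (g m)"
    and tr: "\<And>m. m \<in> M \<Longrightarrow> (\<Sum>k\<in>T. g m k k) = 1"
  shows "Re (hform (S \<times> T) (\<lambda>(i, k) (j, l). \<Sum>m\<in>M. of_real (p m) * (f m i j * g m k l)) v)
    \<le> Re (\<Sum>k\<in>T. hform S (\<lambda>i j. \<Sum>m\<in>M. of_real (p m) * f m i j) (\<lambda>i. v (i, k)))"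
proof -
  have eq: "(\<lambda>(i, k) (j, l). \<Sum>m\<in>M. of_real (p m) * (f m i j * g m k l))
      = (\<lambda>x y. \<Sum>m\<in>M. of_real (p m) * (\<lambda>(i, k) (j, l). f m i j * g m k l) x y)"
    by (auto simp: fun_eq_iff)
  have "Re (hform (S \<times> T) (\<lambda>(i, k) (j, l). \<Sum>m\<in>M. of_real (p m) * (f m i j * g m k l)) v)
      = (\<Sum>m\<in>M. p m * Re (hform (S \<times> T) (\<lambda>(i, k) (j, l). f m i j * g m k l) v))"
    unfolding eq hform_sum by simp
  also have "\<dots> \<le> (\<Sum>m\<in>M. p m * Re (\<Sum>k\<in>T. hform S (f m) (\<lambda>i. v (i, k))))"
    using hform_tensor_le [OF fin f g, where v = v] p tr
    by (intro sum_mono mult_left_mono) force+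
  also have "\<dots> = Re (\<Sum>k\<in>T. hform S (\<lambda>i j. \<Sum>m\<in>M. of_real (p m) * f m i j) (\<lambda>i. v (i, k)))"
    unfolding hform_sum by (subst sum.swap) (simp add: sum_distrib_left)
  finally show ?thesis .
qed

section \<open>Passage from matrices to kernels, tensor indices and the maximally entangled
  state\<close>

lemma mat_adjoint_index:
  fixes A :: "complex mat"
  assumes "A \<in> carrier_mat n m" "i < m" "j < n"
  shows "mat_adjoint A $$ (i, j) = cnj (A $$ (j, i))"
  using assms by (simp add: mat_adjoint_def mat_of_rows_def)

lemma inner_prod_hform:
  assumes "A \<in> carrier_mat n n" "v \<in> carrier_vec n"
  shows "(A *\<^sub>v v) \<bullet>c v = hform {..<n} (\<lambda>i j. A $$ (i, j)) (\<lambda>i. v $ i)"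
  using assms
  by (auto simp: scalar_prod_def hform_def sum_distrib_left atLeast0LessThan mult.commute mult.left_commute
    intro!: sum.cong)

lemma pos_semidef_psd_kernel:
  assumes "pos_semidef n A"
  shows "psd_kernel {..<n} (\<lambda>i j. A $$ (i, j))"
  unfolding psd_kernel_def
proof (intro conjI ballI allI)
  have A: "A \<in> carrier_mat n n" "mat_adjoint A = A" using assms by (auto simp: pos_semidef_def)
  fix i j assume "i \<in> {..<n}" "j \<in> {..<n}"
  then show "A $$ (j, i) = cnj (A $$ (i, j))" using mat_adjoint_index [OF A(1), of j i] A(2) by simp
next
  have A: "A \<in> carrier_mat n n" using assms by (auto simp: pos_semidef_def)
  fix x :: "nat \<Rightarrow> complex"
  have "hform {..<n} (\<lambda>i j. A $$ (i, j)) x = hform {..<n} (\<lambda>i j. A $$ (i, j)) (\<lambda>i. vec n x $ i)"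
    by (intro hform_cong) simp
  also have "\<dots> = (A *\<^sub>v vec n x) \<bullet>c vec n x" using A by (simp add: inner_prod_hform)
  finally show "0 \<le> Re (hform {..<n} (\<lambda>i j. A $$ (i, j)) x)"
    using assms by (auto simp: pos_semidef_def)
qed

lemma sum_tensor_index:
  fixes h :: "nat \<Rightarrow> 'a::comm_monoid_add"
  shows "(\<Sum>a<n * d. h a) = (\<Sum>i<n. \<Sum>k<d. h (i * d + k))"
proof -
  have "(\<Sum>a\<in>{i * d..<i * d + d}. h a) = (\<Sum>k<d. h (i * d + k))" for i
    using sum.shift_bounds_nat_ivl [of h 0 "i * d" d] by (simp add: atLeast0LessThan add.commute)
  then show ?thesis using sum.nat_group [of h d n] by simp
qed

lemma tensor_index_less:
  fixes i k :: nat
  assumes "i < n" "k < d"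
  shows "i * d + k < n * d"
proof -
  have "i * d + k < Suc i * d" using assms by simp
  also have "\<dots> \<le> n * d" using assms by (intro mult_le_mono1) simp
  finally show ?thesis .
qed

text \<open>The maximally entangled state (1/d) sum_ij E_ij (x) E_ij: an index \<open>a\<close> with
  \<open>a div d = a mod d\<close> stands for some e_i (x) e_i.\<close>

definition bell_state :: "nat \<Rightarrow> complex mat" where
  "bell_state d = mat (d * d) (d * d)
     (\<lambda>(a, b). if a div d = a mod d \<and> b div d = b mod d then 1 / of_nat d else 0)"

lemma density_matrix_bell_state:
  assumes "1 \<le> d"
  shows "density_matrix (d * d) (bell_state d)"
  unfolding density_matrix_def pos_semidef_def
proof (intro conjI ballI)
  show carr: "bell_state d \<in> carrier_mat (d * d) (d * d)" by (simp add: bell_state_def)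
  show "mat_adjoint (bell_state d) = bell_state d"
    using carr by (intro eq_matI) (auto simp: mat_adjoint_index, auto simp: mat_adjoint_def bell_state_def)
  fix v :: "complex vec" assume v: "v \<in> carrier_vec (d * d)"
  \<comment> \<open>The unit vector \<open>d^(-1/2)\<close> sum_i e_i (x) e_i. The state is the
    projection onto it, hence a Gram kernel with a single vector, indexed by
    \<open>{0}\<close>.\<close>
  define e :: "nat \<Rightarrow> complex" where "e = (\<lambda>a. if a div d = a mod d then 1 / of_real (sqrt d) else 0)"
  have sq: "complex_of_real (sqrt d) * complex_of_real (sqrt d) = of_nat d"
    by (simp flip: of_real_mult)
  have "(bell_state d *\<^sub>v v) \<bullet>c v
      = of_real (\<Sum>a\<in>{0::nat}. (cmod (\<Sum>i<d * d. cnj (e i) * v $ i))\<^sup>2)"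
    unfolding inner_prod_hform [OF carr v]
    using sq by (intro hform_gram) (simp add: bell_state_def e_def)
  then show "0 \<le> Re ((bell_state d *\<^sub>v v) \<bullet>c v)" by simp
next
  have "matrix_trace (bell_state d) = (\<Sum>i<d. \<Sum>k<d. if i = k then 1 / of_nat d else 0)"
    unfolding matrix_trace_def bell_state_def
    by (simp add: sum_tensor_index tensor_index_less)
  also have "\<dots> = 1" using assms by simp
  finally show "matrix_trace (bell_state d) = 1" .
qed

text \<open>The matrix unit E_ij with the factor 1/d kept inside, so that it is exactly a block of
  \<open>bell_state\<close>.\<close>

definition scaled_unit_mat :: "nat \<Rightarrow> nat \<Rightarrow> nat \<Rightarrow> complex mat" where
  "scaled_unit_mat d i j = mat d d (\<lambda>(s, t). if s = i \<and> t = j then 1 / of_nat d else 0)"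

lemma tensor_block_bell_state:
  assumes "i < d" "j < d"
  shows "tensor_block d (bell_state d) i j = scaled_unit_mat d i j"
  using assms by (intro eq_matI) (auto simp: tensor_block_def bell_state_def scaled_unit_mat_def tensor_index_less)

text \<open>A single Kraus operator contributes a rank-one term to the Choi matrix, because A E_ij
  A^* is column i of A times the adjoint of column j.\<close>

lemma kraus_scaled_unit_mat:
  assumes "A \<in> carrier_mat d d" "i < d" "j < d" "k < d" "l < d"
  shows "(A * scaled_unit_mat d i j * mat_adjoint A) $$ (k, l) = A $$ (k, i) * cnj (A $$ (l, j)) / of_nat d"
proof -
  have adj: "mat_adjoint A \<in> carrier_mat d d" using assms by (auto simp: mat_adjoint_def intro!: mat_of_rows_carrier)
  have "(A * scaled_unit_mat d i j) $$ (k, t) = (if t = j then A $$ (k, i) / of_nat d else 0)" if "t < d" for t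
    using assms that
    by (simp add: scaled_unit_mat_def scalar_prod_def if_distrib [of "\<lambda>z. _ * z"] cong: if_cong)
  moreover have "A * scaled_unit_mat d i j \<in> carrier_mat d d"
    using assms by (simp add: scaled_unit_mat_def)
  ultimately have "(A * scaled_unit_mat d i j * mat_adjoint A) $$ (k, l)
      = (\<Sum>t<d. (if t = j then A $$ (k, i) / of_nat d else 0) * cnj (A $$ (l, t)))"
    using assms adj by (auto simp: scalar_prod_def mat_adjoint_index atLeast0LessThan intro!: sum.cong)
  also have "\<dots> = A $$ (k, i) * cnj (A $$ (l, j)) / of_nat d"
    using assms by (simp add: if_distrib [of "\<lambda>z. z * _"] cong: if_cong)
  finally show ?thesis .
qed

section \<open>The Choi matrix of the channel and the number of Kraus operators\<close>

theorem theorem6: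
  fixes d r :: nat and \<Phi> :: "complex mat \<Rightarrow> complex mat" and A :: "nat \<Rightarrow> complex mat"
  assumes "d \<ge> 1"
    and "CPT d \<Phi>"
    and "\<And>k. k \<in> {1..r} \<Longrightarrow> A k \<in> carrier_mat d d"
    and "\<And>\<rho>. \<rho> \<in> carrier_mat d d \<Longrightarrow>
           \<Phi> \<rho> = matrix_sum d (\<lambda>k. A k * \<rho> * mat_adjoint (A k)) {1..r}"
    and "r < d"
  shows "\<not> EBT d \<Phi>"
proof
  assume "EBT d \<Phi>"
  then have "separable d d (id_tensor_map d d \<Phi> (bell_state d))"
    using density_matrix_bell_state [OF assms(1)] assms(1) by (auto simp: EBT_def)
  then obtain M :: nat and p :: "nat \<Rightarrow> real" and \<rho> \<sigma> where
    p: "\<And>m. m < M \<Longrightarrow> 0 \<le> p m" and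
    \<rho>: "\<And>m. m < M \<Longrightarrow> density_matrix d (\<rho> m)" and
    \<sigma>: "\<And>m. m < M \<Longrightarrow> density_matrix d (\<sigma> m)" and
    dec: "id_tensor_map d d \<Phi> (bell_state d) =
      matrix_sum (d * d) (\<lambda>m. complex_of_real (p m) \<cdot>\<^sub>m tensor_mat d d (\<rho> m) (\<sigma> m)) {..<M}"
    unfolding separable_def by blast
  \<comment> \<open>Vectorised Kraus operators. The column (input) index comes first, because the
    reference system is the first tensor factor.\<close>
  define a where "a = (\<lambda>\<kappa> (i, k). A \<kappa> $$ (k, i))"
  define I where "I = {..<d}"
  have unit: "scaled_unit_mat d i j \<in> carrier_mat d d" for i j
    by (simp add: scaled_unit_mat_def)
  have \<Phi>_unit: "\<Phi> (scaled_unit_mat d i j) $$ (k, l) = (\<Sum>\<kappa>=1..r. a \<kappa> (i, k) * cnj (a \<kappa> (j, l))) / of_nat d"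
    if "i < d" "j < d" "k < d" "l < d" for i j k l
    using that assms(3) unfolding assms(4) [OF unit] matrix_sum_def
    by (simp add: kraus_scaled_unit_mat a_def sum_divide_distrib)
  \<comment> \<open>The same entry of the image of the maximally entangled state, computed from the
    Kraus operators on the left and from the separable decomposition on the right.\<close>
  have choi: "(\<Sum>\<kappa>=1..r. a \<kappa> (i, k) * cnj (a \<kappa> (j, l))) / of_nat d
      = (\<Sum>m<M. of_real (p m) * (\<rho> m $$ (i, j) * \<sigma> m $$ (k, l)))"
    if "i < d" "j < d" "k < d" "l < d" for i j k l
  proof -
    have "id_tensor_map d d \<Phi> (bell_state d) $$ (i * d + k, j * d + l) = \<Phi> (scaled_unit_mat d i j) $$ (k, l)"
      using that by (simp add: id_tensor_map_def tensor_block_bell_state tensor_index_less)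
    then show ?thesis
      using that unfolding dec \<Phi>_unit [OF that]
      by (simp add: matrix_sum_def tensor_mat_def tensor_index_less)
  qed
  \<comment> \<open>Summing over \<open>k\<close> traces out the output, and preservation of the
    trace of E_ij / d gives the marginal 1/d times the identity.\<close>
  have marginal: "(\<Sum>k<d. (\<Sum>\<kappa>=1..r. a \<kappa> (i, k) * cnj (a \<kappa> (j, k))) / of_nat d)
      = (if i = j then 1 / of_nat d else 0)" if "i < d" "j < d" for i j
  proof -
    have "\<Phi> (scaled_unit_mat d i j) \<in> carrier_mat d d"
      using unit unfolding assms(4) [OF unit] by (simp add: matrix_sum_def)
    then have "(\<Sum>k<d. (\<Sum>\<kappa>=1..r. a \<kappa> (i, k) * cnj (a \<kappa> (j, k))) / of_nat d)
        = matrix_trace (\<Phi> (scaled_unit_mat d i j))"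
      using that by (simp add: matrix_trace_def \<Phi>_unit)
    also have "\<dots> = matrix_trace (scaled_unit_mat d i j)"
      using assms(2) unit by (simp add: CPT_def trace_preserving_def)
    also have "\<dots> = (\<Sum>k<d. if k = i then if i = j then 1 / of_nat d else 0 else 0)"
      by (auto simp: matrix_trace_def scaled_unit_mat_def intro!: sum.cong)
    finally show ?thesis using that by simp
  qed
  have tr\<sigma>: "(\<Sum>k\<in>I. \<sigma> m $$ (k, k)) = 1" if "m < M" for m
    using \<sigma> [OF that] by (auto simp: density_matrix_def pos_semidef_def matrix_trace_def I_def)
  \<comment> \<open>Tracing out the second factor of the separable decomposition identifies the
    average of the \<open>\<rho> m\<close> with this marginal.\<close>
  have avg: "(\<Sum>m<M. of_real (p m) * \<rho> m $$ (i, j)) = (if i = j then 1 / of_nat d else 0)"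
    if "i < d" "j < d" for i j
  proof -
    have "(\<Sum>m<M. of_real (p m) * \<rho> m $$ (i, j))
        = (\<Sum>m<M. \<Sum>k\<in>I. of_real (p m) * (\<rho> m $$ (i, j) * \<sigma> m $$ (k, k)))"
      by (intro sum.cong refl) (simp add: sum_distrib_left [symmetric] tr\<sigma>)
    also have "\<dots> = (\<Sum>k\<in>I. \<Sum>m<M. of_real (p m) * (\<rho> m $$ (i, j) * \<sigma> m $$ (k, k)))"
      by (rule sum.swap)
    also have "\<dots> = (\<Sum>k<d. (\<Sum>\<kappa>=1..r. a \<kappa> (i, k) * cnj (a \<kappa> (j, k))) / of_nat d)"
      using that by (simp add: choi [symmetric] I_def)
    finally show ?thesis using marginal [OF that] by simp
  qed
  \<comment> \<open>This is J \<le> 1. The state is J / d and its marginal is 1 / d, so the factor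
    cancels from the reduction criterion.\<close>
  have choi_le: "(\<Sum>\<kappa>=1..r. (cmod (\<Sum>x\<in>I \<times> I. cnj (a \<kappa> x) * v x))\<^sup>2) \<le> (\<Sum>x\<in>I \<times> I. (cmod (v x))\<^sup>2)" for v
  proof -
    have fin: "finite I" by (simp add: I_def)
    define b where "b = (\<lambda>\<kappa> x. a \<kappa> x / of_real (sqrt d))"
    have sq: "complex_of_real (sqrt d) * complex_of_real (sqrt d) = of_nat d"
      by (simp flip: of_real_mult)
    let ?K = "\<lambda>(i, k) (j, l). \<Sum>m<M. of_real (p m) * (\<rho> m $$ (i, j) * \<sigma> m $$ (k, l))"
    have "hform (I \<times> I) ?K v
        = of_real (\<Sum>\<kappa>=1..r. (cmod (\<Sum>x\<in>I \<times> I. cnj (b \<kappa> x) * v x))\<^sup>2)"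
    proof (rule hform_gram)
      fix x y assume "x \<in> I \<times> I" "y \<in> I \<times> I"
      then show "?K x y = (\<Sum>\<kappa>=1..r. b \<kappa> x * cnj (b \<kappa> y))"
        using sq by (auto simp: I_def choi [symmetric] b_def sum_divide_distrib)
    qed
    also have "\<dots> = of_real ((\<Sum>\<kappa>=1..r. (cmod (\<Sum>x\<in>I \<times> I. cnj (a \<kappa> x) * v x))\<^sup>2) / d)"
      by (simp add: b_def sum_divide_distrib [symmetric] norm_divide power_divide)
    finally have "(\<Sum>\<kappa>=1..r. (cmod (\<Sum>x\<in>I \<times> I. cnj (a \<kappa> x) * v x))\<^sup>2) / d = Re (hform (I \<times> I) ?K v)"
      by simp
    also have "\<dots> \<le> Re (\<Sum>k\<in>I. hform I (\<lambda>i j. \<Sum>m<M. of_real (p m) * \<rho> m $$ (i, j)) (\<lambda>i. v (i, k)))"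
      using p \<rho> \<sigma> tr\<sigma>
      by (intro reduction_criterion fin)
        (auto simp: density_matrix_def I_def intro: pos_semidef_psd_kernel)
    also have "\<dots> = (\<Sum>k\<in>I. \<Sum>i\<in>I. (cmod (v (i, k)))\<^sup>2 / d)"
    proof -
      have "hform I (\<lambda>i j. \<Sum>m<M. of_real (p m) * \<rho> m $$ (i, j)) x
          = (\<Sum>i\<in>I. \<Sum>j\<in>I. if i = j then cnj (x i) * x i / of_nat d else 0)" for x
        unfolding hform_def by (intro sum.cong refl) (auto simp: avg I_def)
      also have "(\<Sum>i\<in>I. \<Sum>j\<in>I. if i = j then cnj (x i) * x i / of_nat d else 0)
          = of_real (\<Sum>i\<in>I. (cmod (x i))\<^sup>2 / d)" for x
        using fin by (simp add: complex_norm_square mult.commute del: of_real_power)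
      finally show ?thesis by simp
    qed
    also have "\<dots> = (\<Sum>x\<in>I \<times> I. (cmod (v x))\<^sup>2) / d"
      by (subst sum.swap) (simp add: sum.cartesian_product sum_divide_distrib)
    finally show ?thesis using assms(1) by (simp add: divide_le_cancel)
  qed
  have le1: "(\<Sum>x\<in>I \<times> I. (cmod (a \<kappa> x))\<^sup>2) \<le> 1" (is "?N \<le> 1") if "\<kappa> \<in> {1..r}" for \<kappa>
  proof -
    have "(\<Sum>x\<in>I \<times> I. cnj (a \<kappa> x) * a \<kappa> x) = of_real ?N"
      by (simp add: complex_norm_square mult.commute del: of_real_power)
    then have "?N\<^sup>2 = (cmod (\<Sum>x\<in>I \<times> I. cnj (a \<kappa> x) * a \<kappa> x))\<^sup>2"
      by (simp only: norm_of_real power2_abs)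
    \<comment> \<open>Only the summand \<open>\<mu> = \<kappa>\<close> is kept; the others are
      nonnegative.\<close>
    also have "\<dots> \<le> (\<Sum>\<mu>=1..r. (cmod (\<Sum>x\<in>I \<times> I. cnj (a \<mu> x) * a \<kappa> x))\<^sup>2)"
      using that by (intro member_le_sum) auto
    also have "\<dots> \<le> ?N" by (rule choi_le)
    finally have "?N * ?N \<le> ?N * 1" by (simp add: power2_eq_square)
    moreover have "0 \<le> ?N" by (intro sum_nonneg) simp
    ultimately show ?thesis by (cases "?N = 0") (auto simp: mult_le_cancel_left)
  qed
  \<comment> \<open>The trace of J, read off from the diagonal entries of the marginal.\<close>
  have "complex_of_real (\<Sum>\<kappa>=1..r. \<Sum>x\<in>I \<times> I. (cmod (a \<kappa> x))\<^sup>2)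
      = (\<Sum>x\<in>I \<times> I. \<Sum>\<kappa>=1..r. a \<kappa> x * cnj (a \<kappa> x))"
    by (subst sum.swap) (simp add: complex_norm_square del: of_real_power)
  also have "\<dots> = of_nat d * (\<Sum>i<d. \<Sum>k<d. (\<Sum>\<kappa>=1..r. a \<kappa> (i, k) * cnj (a \<kappa> (i, k))) / of_nat d)"
    using assms(1) by (simp add: sum_divide_distrib [symmetric] I_def sum.cartesian_product')
  also have "\<dots> = of_nat d * (\<Sum>i<d. 1 / of_nat d)"
    by (intro arg_cong2 [where f = "(*)"] sum.cong refl) (simp only: lessThan_iff marginal simp_thms if_True)
  also have "\<dots> = complex_of_real d"
    using assms(1) by simp
  finally have "(\<Sum>\<kappa>=1..r. \<Sum>x\<in>I \<times> I. (cmod (a \<kappa> x))\<^sup>2) = d"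
    by (simp only: of_real_eq_iff)
  moreover have "(\<Sum>\<kappa>=1..r. \<Sum>x\<in>I \<times> I. (cmod (a \<kappa> x))\<^sup>2) \<le> (\<Sum>\<kappa>=1..r. 1)"
    using le1 by (rule sum_mono)
  ultimately show False using assms(5) by simp
qed

end
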